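(* Let $\mathcal{B}$ be a nondegenerate symmetric left-invariant bilinear form on a Leibniz algebra $(A,\circ_A)$. Define multiplications $\succ_A,\prec_A:A\otimes A\to A$ by $$\mathcal{B}(x\succ_A y,z)=-\mathcal{B}(y,\,x\circ_A z+z\circ_A x),\qquad \mathcal{B}(x\prec_A y,z)=-\mathcal{B}(x,\,z\circ_A y),\qquad\forall x,y,z\in A.$$ Then $(A,\succ_A,\prec_A,\mathcal{B})$ is a quadratic special type-$a$ pre-Leibniz algebra. Conversely, let $(A,\succ_A,\prec_A,\mathcal{B})$ be a quadratic special type-$a$ pre-Leibniz algebra. Then $\mathcal{B}$ is left-invariant on the sub-adjacent Leibniz algebra $(A,\circ_A)$. Hence there is a one-to-one correspondence between Leibniz algebras with nondegenerate symmetric left-invariant bilinear forms and quadratic special type-$a$ pre-Leibniz algebras.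
   Context: All vector spaces are finite-dimensional over an algebraically closed field $\mathbb{K}$ of characteristic zero. A Leibniz algebra is a vector space $A$ with a bilinear multiplication $\circ_A$ such that $x\circ_A(y\circ_A z)=(x\circ_A y)\circ_A z+y\circ_A(x\circ_A z)$ for all $x,y,z\in A$. A bilinear form $\mathcal{B}$ on a Leibniz algebra $(A,\circ_A)$ is left-invariant if $\mathcal{B}(x\circ_A y,z)+\mathcal{B}(y,x\circ_A z)=0$ for all $x,y,z\in A$. A special type-$a$ pre-Leibniz algebra (with $a=\begin{pmatrix}1&-1\\-1&0\end{pmatrix}$) is a vector space $A$ with bilinear multiplications $\succ_A,\prec_A$ such that $\prec_A$ is anticommutative ($x\prec_A y=-y\prec_A x$), $(A,\circ_A)$ with $x\circ_A y:=x\succ_A y+x\prec_A y$ is a Leibniz algebra (called the sub-adjacent Leibniz algebra), and $$x\circ_A(y\prec_A z)=(x\circ_A y)\prec_A z+y\prec_A(x\circ_A z)=x\prec_A(y\prec_A z),\quad\forall x,y,z\in A.$$ A symmetric bilinear form $\mathcal{B}$ on a special type-$a$ pre-Leibniz algebra $(A,\succ_A,\prec_A)$ is invariant if $\mathcal{B}(x\prec_A y,z)=-\mathcal{B}(x,z\circ_A y)$ for all $x,y,z\in A$. A quadratic special type-$a$ pre-Leibniz algebra $(A,\succ_A,\prec_A,\mathcal{B})$ is a special type-$a$ pre-Leibniz algebra together with a nondegenerate symmetric invariant bilinear form $\mathcal{B}$. *)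

theory Defs
  imports Main "HOL-Computational_Algebra.Polynomial"
begin

text \<open>
  The underlying vector space of an algebra is a whole type \<open>'v\<close> with an explicit scalar
  multiplication. Finite-dimensionality, algebraic closedness and characteristic zero play no
  role in the definitions and are imposed only where needed.
\<close>

definition bilinear_map ::
  "('k::field \<Rightarrow> 'a::ab_group_add \<Rightarrow> 'a) \<Rightarrow> ('k \<Rightarrow> 'b::ab_group_add \<Rightarrow> 'b)
    \<Rightarrow> ('k \<Rightarrow> 'c::ab_group_add \<Rightarrow> 'c) \<Rightarrow> ('a \<Rightarrow> 'b \<Rightarrow> 'c) \<Rightarrow> bool"
  where "bilinear_map s1 s2 s3 f \<longleftrightarrow>
    (\<forall>x. Vector_Spaces.linear s2 s3 (f x)) \<and> (\<forall>y. Vector_Spaces.linear s1 s3 (\<lambda>x. f x y))"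

locale leibniz_algebra = vector_space scale
  for scale :: "'k::field \<Rightarrow> 'v::ab_group_add \<Rightarrow> 'v" +
  fixes mul :: "'v \<Rightarrow> 'v \<Rightarrow> 'v"
  assumes bilinear_mul: "bilinear_map scale scale scale mul"
    and leibniz: "mul x (mul y z) = mul (mul x y) z + mul y (mul x z)"

definition bilinear_form ::
  "('k::field \<Rightarrow> 'v::ab_group_add \<Rightarrow> 'v) \<Rightarrow> ('v \<Rightarrow> 'v \<Rightarrow> 'k) \<Rightarrow> bool"
  where "bilinear_form scale B \<longleftrightarrow> bilinear_map scale scale (*) B"

definition symmetric_form :: "('v \<Rightarrow> 'v \<Rightarrow> 'k) \<Rightarrow> bool"
  where "symmetric_form B \<longleftrightarrow> (\<forall>x y. B x y = B y x)"

definition nondegenerate_form :: "('v::ab_group_add \<Rightarrow> 'v \<Rightarrow> 'k::field) \<Rightarrow> bool"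
  where "nondegenerate_form B \<longleftrightarrow>
    (\<forall>x. (\<forall>y. B x y = 0) \<longrightarrow> x = 0) \<and> (\<forall>y. (\<forall>x. B x y = 0) \<longrightarrow> y = 0)"

definition left_invariant :: "('v \<Rightarrow> 'v \<Rightarrow> 'v) \<Rightarrow> ('v \<Rightarrow> 'v \<Rightarrow> 'k::field) \<Rightarrow> bool"
  where "left_invariant mul B \<longleftrightarrow> (\<forall>x y z. B (mul x y) z + B y (mul x z) = 0)"

locale leibniz_algebra_with_form = leibniz_algebra scale mul
  for scale :: "'k::field \<Rightarrow> 'v::ab_group_add \<Rightarrow> 'v" and mul :: "'v \<Rightarrow> 'v \<Rightarrow> 'v" +
  fixes B :: "'v \<Rightarrow> 'v \<Rightarrow> 'k"
  assumes bilinear_form: "bilinear_form scale B"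
    and symmetric_form: "symmetric_form B"
    and nondegenerate_form: "nondegenerate_form B"
    and left_invariant: "left_invariant mul B"

definition sub_adjacent ::
  "('v \<Rightarrow> 'v \<Rightarrow> 'v::ab_group_add) \<Rightarrow> ('v \<Rightarrow> 'v \<Rightarrow> 'v) \<Rightarrow> 'v \<Rightarrow> 'v \<Rightarrow> 'v"
  where "sub_adjacent succ prec x y = succ x y + prec x y"

text \<open>Throughout, \<open>succ\<close> and \<open>prec\<close> stand for the multiplications \<open>\<succ>\<close> and \<open>\<prec>\<close>.
  The type is \<open>a = (1, -1; -1, 0)\<close>.\<close>

locale special_pre_leibniz_algebra = vector_space scale
  for scale :: "'k::field \<Rightarrow> 'v::ab_group_add \<Rightarrow> 'v" +
  fixes succ prec :: "'v \<Rightarrow> 'v \<Rightarrow> 'v"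
  assumes bilinear_succ: "bilinear_map scale scale scale succ"
    and bilinear_prec: "bilinear_map scale scale scale prec"
    and anticommutative: "prec x y = - prec y x"
    and leibniz_sub_adjacent: "leibniz_algebra scale (sub_adjacent succ prec)"
    and derivation:
      "sub_adjacent succ prec x (prec y z)
        = prec (sub_adjacent succ prec x y) z + prec y (sub_adjacent succ prec x z)"
    and special:
      "prec (sub_adjacent succ prec x y) z + prec y (sub_adjacent succ prec x z)
        = prec x (prec y z)"

definition pre_leibniz_invariant ::
  "('v \<Rightarrow> 'v \<Rightarrow> 'v::ab_group_add) \<Rightarrow> ('v \<Rightarrow> 'v \<Rightarrow> 'v) \<Rightarrow> ('v \<Rightarrow> 'v \<Rightarrow> 'k::field) \<Rightarrow> bool"
  where "pre_leibniz_invariant succ prec B \<longleftrightarrow>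
    (\<forall>x y z. B (prec x y) z = - B x (sub_adjacent succ prec z y))"

locale quadratic_special_pre_leibniz_algebra = special_pre_leibniz_algebra scale succ prec
  for scale :: "'k::field \<Rightarrow> 'v::ab_group_add \<Rightarrow> 'v" and succ prec :: "'v \<Rightarrow> 'v \<Rightarrow> 'v" +
  fixes B :: "'v \<Rightarrow> 'v \<Rightarrow> 'k"
  assumes bilinear_form: "bilinear_form scale B"
    and symmetric_form: "symmetric_form B"
    and nondegenerate_form: "nondegenerate_form B"
    and invariant: "pre_leibniz_invariant succ prec B"

definition is_induced_succ ::
  "('v \<Rightarrow> 'v \<Rightarrow> 'v::ab_group_add) \<Rightarrow> ('v \<Rightarrow> 'v \<Rightarrow> 'k::field) \<Rightarrow> ('v \<Rightarrow> 'v \<Rightarrow> 'v) \<Rightarrow> bool"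
  where "is_induced_succ mul B succ \<longleftrightarrow>
    (\<forall>x y z. B (succ x y) z = - B y (mul x z + mul z x))"

definition is_induced_prec ::
  "('v \<Rightarrow> 'v \<Rightarrow> 'v) \<Rightarrow> ('v \<Rightarrow> 'v \<Rightarrow> 'k::field) \<Rightarrow> ('v \<Rightarrow> 'v \<Rightarrow> 'v) \<Rightarrow> bool"
  where "is_induced_prec mul B prec \<longleftrightarrow> (\<forall>x y z. B (prec x y) z = - B x (mul z y))"

text \<open>Meaningful only where the defining equations have a unique solution, as they do for
  nondegenerate \<open>B\<close> in finite dimension.\<close>

definition induced_succ ::
  "('v \<Rightarrow> 'v \<Rightarrow> 'v::ab_group_add) \<Rightarrow> ('v \<Rightarrow> 'v \<Rightarrow> 'k::field) \<Rightarrow> 'v \<Rightarrow> 'v \<Rightarrow> 'v"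
  where "induced_succ mul B = (THE succ. is_induced_succ mul B succ)"

definition induced_prec ::
  "('v \<Rightarrow> 'v \<Rightarrow> 'v) \<Rightarrow> ('v \<Rightarrow> 'v \<Rightarrow> 'k::field) \<Rightarrow> 'v \<Rightarrow> 'v \<Rightarrow> 'v"
  where "induced_prec mul B = (THE prec. is_induced_prec mul B prec)"

text \<open>All structures of the two kinds on a fixed vector space.\<close>

definition leibniz_with_form_structures ::
  "('k::field \<Rightarrow> 'v::ab_group_add \<Rightarrow> 'v) \<Rightarrow> (('v \<Rightarrow> 'v \<Rightarrow> 'v) \<times> ('v \<Rightarrow> 'v \<Rightarrow> 'k)) set"
  where "leibniz_with_form_structures scale = {(mul, B). leibniz_algebra_with_form scale mul B}"

definition quadratic_special_structures ::
  "('k::field \<Rightarrow> 'v::ab_group_add \<Rightarrow> 'v)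
    \<Rightarrow> (('v \<Rightarrow> 'v \<Rightarrow> 'v) \<times> ('v \<Rightarrow> 'v \<Rightarrow> 'v) \<times> ('v \<Rightarrow> 'v \<Rightarrow> 'k)) set"
  where "quadratic_special_structures scale =
    {(succ, prec, B). quadratic_special_pre_leibniz_algebra scale succ prec B}"

definition to_quadratic ::
  "('v \<Rightarrow> 'v \<Rightarrow> 'v::ab_group_add) \<times> ('v \<Rightarrow> 'v \<Rightarrow> 'k::field)
    \<Rightarrow> ('v \<Rightarrow> 'v \<Rightarrow> 'v) \<times> ('v \<Rightarrow> 'v \<Rightarrow> 'v) \<times> ('v \<Rightarrow> 'v \<Rightarrow> 'k)"
  where "to_quadratic = (\<lambda>(mul, B). (induced_succ mul B, induced_prec mul B, B))"

definition to_leibniz ::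
  "('v \<Rightarrow> 'v \<Rightarrow> 'v::ab_group_add) \<times> ('v \<Rightarrow> 'v \<Rightarrow> 'v) \<times> ('v \<Rightarrow> 'v \<Rightarrow> 'k::field)
    \<Rightarrow> ('v \<Rightarrow> 'v \<Rightarrow> 'v) \<times> ('v \<Rightarrow> 'v \<Rightarrow> 'k)"
  where "to_leibniz = (\<lambda>(succ, prec, B). (sub_adjacent succ prec, B))"

end

theory Submission
  imports Defs
begin

text \<open>
  Nondegeneracy lets every identity be tested against a further argument of \<open>B\<close>. Left-invariance
  and symmetry give \<open>B (prec x y) z = B (mul z x) y\<close>, which makes \<open>prec\<close> anticommutative and
  turns the definition of \<open>succ\<close> into \<open>succ x y = mul x y - prec x y\<close>; so the sub-adjacent
  multiplication is the original one. The derivation axiom becomes the Leibniz identity, and the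
  special axiom becomes \<open>mul (mul x w + mul w x) z = 0\<close>, which follows from the Leibniz identity
  by symmetrising in \<open>x\<close> and \<open>w\<close>.
\<close>

section \<open>Bilinear maps, nondegenerate symmetric forms and the functionals they
  represent\<close>

lemma bilinear_map_iff:
  assumes "vector_space s1" "vector_space s2" "vector_space s3"
  shows "bilinear_map s1 s2 s3 f \<longleftrightarrow>
    (\<forall>x y z. f (x + y) z = f x z + f y z) \<and> (\<forall>x y z. f x (y + z) = f x y + f x z) \<and>
    (\<forall>c x y. f (s1 c x) y = s3 c (f x y)) \<and> (\<forall>c x y. f x (s2 c y) = s3 c (f x y))"
proof -
  show ?thesis
    unfolding bilinear_map_def Vector_Spaces.linear_iff using assms by blast
qed

lemma vector_space_mult: "vector_space ((*) :: 'k::field \<Rightarrow> 'k \<Rightarrow> 'k)"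
  by unfold_locales (simp_all add: algebra_simps)

lemma bilinear_form_iff:
  assumes "vector_space scale"
  shows "bilinear_form scale B \<longleftrightarrow>
    (\<forall>x y z. B (x + y) z = B x z + B y z) \<and> (\<forall>x y z. B x (y + z) = B x y + B x z) \<and>
    (\<forall>c x y. B (scale c x) y = c * B x y) \<and> (\<forall>c x y. B x (scale c y) = c * B x y)"
  unfolding bilinear_form_def by (rule bilinear_map_iff[OF assms assms vector_space_mult])

text \<open>Common ground of both kinds of structure: each is made a sublocale, so the rules for
  computing with \<open>B\<close> are shared by the two directions.\<close>

locale nondegenerate_symmetric_form = vector_space scale
  for scale :: "'k::field \<Rightarrow> 'v::ab_group_add \<Rightarrow> 'v" +
  fixes B :: "'v \<Rightarrow> 'v \<Rightarrow> 'k"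
  assumes form_bilinear: "bilinear_form scale B"
    and form_symmetric: "symmetric_form B"
    and form_nondegenerate: "nondegenerate_form B"
begin

lemma form_simps [simp]:
  "B (x + y) z = B x z + B y z" "B x (y + z) = B x y + B x z"
  "B (scale c x) y = c * B x y" "B x (scale c y) = c * B x y"
  using form_bilinear unfolding bilinear_form_iff[OF vector_space_axioms] by blast+

lemma form_zero [simp]: "B 0 y = 0" "B x 0 = 0"
  using form_simps(3)[of 0 0 y] form_simps(4)[of x 0 0] by (simp_all del: form_simps)

lemma form_minus [simp]: "B (- x) y = - B x y" "B x (- y) = - B x y"
  using form_simps(1)[of x "- x" y] form_simps(2)[of x y "- y"]
  by (simp_all add: eq_neg_iff_add_eq_0 add.commute)

lemma form_diff [simp]: "B (x - y) z = B x z - B y z"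
  using form_simps(1)[of x "- y" z] by simp

lemma form_commute: "B x y = B y x"
  using form_symmetric by (simp add: symmetric_form_def)

lemma form_eqI:
  assumes "\<And>z. B x z = B y z"
  shows "x = y"
proof -
  have "\<forall>z. B (x - y) z = 0"
    using assms by simp
  then have "x - y = 0"
    using form_nondegenerate unfolding nondegenerate_form_def by blast
  then show ?thesis
    by simp
qed

text \<open>Source of every uniqueness claim: each induced multiplication is specified only through
  its pairing with a third argument.\<close>

lemma representing_map_unique:
  assumes "\<forall>x y z. B (f x y) z = F x y z" "\<forall>x y z. B (g x y) z = F x y z"
  shows "f = g"
  using assms by (auto intro!: ext form_eqI)

end

text \<open>A linear endomorphism \<open>T\<close> encodes the functional \<open>B x\<close> by its
  values on \<open>Basis\<close>. Nondegeneracy makes \<open>T\<close> injective, finite dimension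
  then makes it surjective, and a preimage of the vector with coordinates \<open>f b\<close>
  represents \<open>f\<close>.\<close>

lemma (in finite_dimensional_vector_space) form_represents_functional:
  assumes "nondegenerate_symmetric_form scale B" and "Vector_Spaces.linear scale (*) f"
  shows "\<exists>u. \<forall>z. B u z = f z"
proof -
  interpret nondegenerate_symmetric_form scale B by fact
  interpret func: vector_space_pair scale "(*)"
    by (simp add: vector_space_pair_def vector_space_axioms vector_space_mult)
  define T where "T = (\<lambda>x. \<Sum>b\<in>Basis. scale (B x b) b)"
  have T_linear: "Vector_Spaces.linear scale scale T"
    unfolding T_def
    by (auto simp: Vector_Spaces.linear_iff vector_space_axioms scale_left_distrib sum.distrib scale_sum_right)
  have coeffs_eq: "u b = v b"
    if "(\<Sum>b\<in>Basis. scale (u b) b) = (\<Sum>b\<in>Basis. scale (v b) b)" "b \<in> Basis" for u v b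
  proof -
    have "(\<Sum>b\<in>Basis. scale (u b - v b) b) = 0"
      using that(1) by (simp add: scale_left_diff_distrib sum_subtractf)
    then show ?thesis
      using independentD[OF independent_Basis finite_Basis order_refl _ that(2), of "\<lambda>b. u b - v b"]
      by simp
  qed
  have agree_on_Basis: "g = h"
    if "Vector_Spaces.linear scale (*) g" "Vector_Spaces.linear scale (*) h"
      "\<And>b. b \<in> Basis \<Longrightarrow> g b = h b" for g h
  proof
    show "g x = h x" for x
      by (rule func.linear_eq_on[OF that(1,2), where B = Basis])
        (auto simp: span_Basis that(3))
  qed
  have B_linear: "Vector_Spaces.linear scale (*) (B x)" for x
    using form_bilinear by (simp add: bilinear_form_def bilinear_map_def)
  have "inj T"
  \<comment> \<open>Equal images mean equal pairings with every basis vector, hence with every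
    vector.\<close>
  proof (rule injI)
    fix x y assume "T x = T y"
    then have "B x b = B y b" if "b \<in> Basis" for b
      using coeffs_eq that unfolding T_def by blast
    then have "B x = B y"
      by (rule agree_on_Basis[OF B_linear B_linear])
    then show "x = y"
      by (intro form_eqI) simp
  qed
  then have "surj T"
    using linear_inj_imp_surj[OF T_linear] by blast
  then obtain u where "T u = (\<Sum>b\<in>Basis. scale (f b) b)"
    by (metis surjD)
  then have "B u b = f b" if "b \<in> Basis" for b
    using coeffs_eq that unfolding T_def by blast
  then have "B u = f"
    by (rule agree_on_Basis[OF B_linear assms(2)])
  then show ?thesis
    by auto
qed

section \<open>From Leibniz algebras with a form to quadratic structures\<close>

sublocale leibniz_algebra_with_form \<subseteq> nondegenerate_symmetric_form scale B
  by unfold_locales (fact bilinear_form symmetric_form nondegenerate_form)+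

context leibniz_algebra_with_form
begin

lemma mul_simps:
  "mul (x + y) z = mul x z + mul y z" "mul x (y + z) = mul x y + mul x z"
  "mul (scale c x) y = scale c (mul x y)" "mul x (scale c y) = scale c (mul x y)"
  using bilinear_mul
  unfolding bilinear_map_iff[OF vector_space_axioms vector_space_axioms vector_space_axioms]
  by blast+

lemma form_mul: "B (mul x y) z = - B y (mul x z)"
  using left_invariant by (simp add: left_invariant_def eq_neg_iff_add_eq_0)

text \<open>In the sum of the Leibniz identities for \<open>x, y, z\<close> and
  \<open>y, x, z\<close> the nested products \<open>mul x (mul y z)\<close> and
  \<open>mul y (mul x z)\<close> cancel.\<close>

lemma mul_symmetrized: "mul (mul x y + mul y x) z = 0"
  using leibniz[of x y z] leibniz[of y x z] by (simp add: mul_simps)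

lemma induced_prec_form:
  assumes "is_induced_prec mul B prec"
  shows "B (prec x y) z = B (mul z x) y"
  using assms by (simp add: is_induced_prec_def form_mul)

text \<open>Reduces existence and uniqueness of \<open>succ\<close> to the existence of
  \<open>prec\<close>: left-invariance turns \<open>mul x y\<close> into the summand
  \<open>- B y (mul x z)\<close>, and subtracting \<open>prec x y\<close> contributes
  \<open>- B y (mul z x)\<close>.\<close>

lemma induced_succ_iff:
  assumes "is_induced_prec mul B prec"
  shows "is_induced_succ mul B succ \<longleftrightarrow> succ = (\<lambda>x y. mul x y - prec x y)"
proof -
  have *: "B (mul x y - prec x y) z = - B y (mul x z + mul z x)" for x y z
    by (simp add: induced_prec_form[OF assms] form_mul form_commute[of y])
  show ?thesis
    unfolding is_induced_succ_def
  proof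
    assume "\<forall>x y z. B (succ x y) z = - B y (mul x z + mul z x)"
    then show "succ = (\<lambda>x y. mul x y - prec x y)"
      by (rule representing_map_unique) (use * in blast)
  qed (use * in blast)
qed

lemma sub_adjacent_induced:
  assumes "is_induced_succ mul B succ" "is_induced_prec mul B prec"
  shows "sub_adjacent succ prec = mul"
  using assms by (simp add: induced_succ_iff[OF assms(2)] sub_adjacent_def fun_eq_iff)

lemma induced_prec_unique:
  assumes "is_induced_prec mul B prec" "is_induced_prec mul B prec'"
  shows "prec = prec'"
  using assms unfolding is_induced_prec_def by (rule representing_map_unique)

lemma induced_quadratic:
  assumes succ: "is_induced_succ mul B succ" and prec: "is_induced_prec mul B prec"
  shows "quadratic_special_pre_leibniz_algebra scale succ prec B"
proof -
  note bilin = bilinear_map_iff[OF vector_space_axioms vector_space_axioms vector_space_axioms]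
  note adj = sub_adjacent_induced[OF succ prec]
  note form_prec = induced_prec_form[OF prec]
  have form_prec_right: "B (prec x y) z = - B x (mul z y)" for x y z
    using prec by (simp add: is_induced_prec_def)
  \<comment> \<open>Tested against \<open>z\<close>, \<open>prec x y\<close> becomes
    \<open>B (mul z x) y\<close>, which is bilinear in \<open>x\<close> and \<open>y\<close>;
    nondegeneracy carries this back to \<open>prec\<close>.\<close>
  have prec_bilinear: "bilinear_map scale scale scale prec"
    unfolding bilin by (intro conjI allI form_eqI) (simp_all add: form_prec mul_simps)
  moreover have "succ = (\<lambda>x y. mul x y - prec x y)"
    using succ induced_succ_iff[OF prec] by simp
  ultimately have succ_bilinear: "bilinear_map scale scale scale succ"
    by (simp add: bilin mul_simps algebra_simps)
  \<comment> \<open>The two sides are expanded by different formulas for \<open>prec\<close>, so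
    that both become \<open>B y (mul z x)\<close>.\<close>
  have anticommutative: "prec x y = - prec y x" for x y
    by (rule form_eqI) (simp add: form_prec[of x] form_prec_right[of y] form_commute[of _ y])
  have derivation: "mul x (prec y z) = prec (mul x y) z + prec y (mul x z)" for x y z
  proof (rule form_eqI)
    fix w
    \<comment> \<open>Everything except \<open>y\<close> is moved to the second argument, so the
      Leibniz identity for \<open>x, w, z\<close> applies there; its two terms are then moved back
      separately.\<close>
    have "B (mul x (prec y z)) w = B y (mul (mul x w) z)"
      by (simp add: form_mul form_prec_right)
    also have "mul (mul x w) z = mul x (mul w z) - mul w (mul x z)"
      using leibniz[of x w z] by simp
    also have "B y \<dots> = B (prec (mul x y) z + prec y (mul x z)) w"
      by (simp add: form_prec_right form_mul form_commute[of y])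
    finally show "B (mul x (prec y z)) w = B (prec (mul x y) z + prec y (mul x z)) w" .
  qed
  \<comment> \<open>By \<open>derivation\<close> the sum in the special axiom may be replaced by
    \<open>mul x (prec y z)\<close>. Pairing with \<open>w\<close>, the two sides then differ only
    by exchanging \<open>x\<close> and \<open>w\<close> with a sign.\<close>
  have special: "mul x (prec y z) = prec x (prec y z)" for x y z
  proof (rule form_eqI)
    fix w
    have "mul (mul x w) z = - mul (mul w x) z"
      using mul_symmetrized[of x w z] by (simp add: mul_simps eq_neg_iff_add_eq_0)
    then have "B (mul x (prec y z)) w = - B y (mul (mul w x) z)"
      by (simp add: form_mul form_prec_right)
    also have "\<dots> = B (prec x (prec y z)) w"
      by (simp add: form_prec[of x] form_prec_right[of y, symmetric] form_commute[of "mul w x"])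
    finally show "B (mul x (prec y z)) w = B (prec x (prec y z)) w" .
  qed
  show ?thesis
  proof (intro quadratic_special_pre_leibniz_algebra.intro special_pre_leibniz_algebra.intro
      quadratic_special_pre_leibniz_algebra_axioms.intro special_pre_leibniz_algebra_axioms.intro)
    show "vector_space scale" by (rule vector_space_axioms)
    show "bilinear_map scale scale scale succ" by fact
    show "bilinear_map scale scale scale prec" by fact
    show "prec x y = - prec y x" for x y by fact
    show "leibniz_algebra scale (sub_adjacent succ prec)"
      unfolding adj by (rule leibniz_algebra_axioms)
    show "sub_adjacent succ prec x (prec y z)
        = prec (sub_adjacent succ prec x y) z + prec y (sub_adjacent succ prec x z)" for x y z
      unfolding adj by (rule derivation)
    show "prec (sub_adjacent succ prec x y) z + prec y (sub_adjacent succ prec x z)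
        = prec x (prec y z)" for x y z
      unfolding adj derivation[symmetric] by (rule special)
    show "bilinear_form scale B" "symmetric_form B" "nondegenerate_form B"
      by (fact form_bilinear form_symmetric form_nondegenerate)+
    show "pre_leibniz_invariant succ prec B"
      unfolding pre_leibniz_invariant_def adj using form_prec_right by blast
  qed
qed

text \<open>For fixed \<open>x\<close> and \<open>y\<close> the prescribed value is a linear
  functional of \<open>z\<close>, so finite dimension supplies a representing vector, and choice
  over \<open>x\<close> and \<open>y\<close> assembles these into \<open>prec\<close>.\<close>

lemma induced_prec_exists:
  assumes "finite_dimensional_vector_space scale Basis"
  shows "\<exists>prec. is_induced_prec mul B prec"
proof -
  interpret finite_dimensional_vector_space scale Basis by fact
  have "\<exists>u. \<forall>z. B u z = - B x (mul z y)" for x y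
    by (rule form_represents_functional[OF nondegenerate_symmetric_form_axioms])
      (simp add: Vector_Spaces.linear_iff vector_space_axioms vector_space_mult mul_simps)
  then show ?thesis
    unfolding is_induced_prec_def by metis
qed

end

section \<open>From quadratic structures back to Leibniz algebras\<close>

sublocale quadratic_special_pre_leibniz_algebra \<subseteq> nondegenerate_symmetric_form scale B
  by unfold_locales (fact bilinear_form symmetric_form nondegenerate_form)+

context quadratic_special_pre_leibniz_algebra
begin

lemma form_prec: "B (prec x y) z = - B x (sub_adjacent succ prec z y)"
  using invariant by (simp add: pre_leibniz_invariant_def)

text \<open>Invariance trades a sub-adjacent product for \<open>prec\<close>, anticommutativity
  swaps the factors of \<open>prec\<close>, and invariance trades back.\<close>

lemma left_invariant_sub_adjacent: "left_invariant (sub_adjacent succ prec) B"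
  unfolding left_invariant_def
proof (intro allI)
  fix x y z
  have "B y (sub_adjacent succ prec x z) = - B (prec y z) x"
    by (simp add: form_prec)
  also have "\<dots> = B (prec z y) x"
    by (subst anticommutative) simp
  also have "\<dots> = - B (sub_adjacent succ prec x y) z"
    by (simp add: form_prec form_commute[of z])
  finally show "B (sub_adjacent succ prec x y) z + B y (sub_adjacent succ prec x z) = 0"
    by simp
qed

lemma leibniz_algebra_with_form_sub_adjacent:
  "leibniz_algebra_with_form scale (sub_adjacent succ prec) B"
  using leibniz_sub_adjacent form_bilinear form_symmetric form_nondegenerate
    left_invariant_sub_adjacent
  by (simp add: leibniz_algebra_with_form_def leibniz_algebra_with_form_axioms_def)

lemma is_induced_prec_sub_adjacent: "is_induced_prec (sub_adjacent succ prec) B prec"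
  by (simp add: is_induced_prec_def form_prec)

text \<open>Needed to recover the original structure on the round trip: by
  \<open>induced_succ_iff\<close> the claim is that \<open>succ\<close> equals the sub-adjacent
  product minus \<open>prec\<close>.\<close>

lemma is_induced_succ_sub_adjacent: "is_induced_succ (sub_adjacent succ prec) B succ"
  unfolding leibniz_algebra_with_form.induced_succ_iff
    [OF leibniz_algebra_with_form_sub_adjacent is_induced_prec_sub_adjacent]
  by (simp add: sub_adjacent_def fun_eq_iff)

end

section \<open>The correspondence on a fixed finite-dimensional space\<close>

theorem proposition3p22:
  fixes scale :: "'k::{alg_closed_field, field_char_0} \<Rightarrow> 'v::ab_group_add \<Rightarrow> 'v"
    and Basis :: "'v set"
  assumes "finite_dimensional_vector_space scale Basis"
  shows
    "(\<forall>mul B. leibniz_algebra_with_form scale mul B \<longrightarrow>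
        (\<exists>!succ. is_induced_succ mul B succ) \<and>
        (\<exists>!prec. is_induced_prec mul B prec) \<and>
        (\<forall>succ prec. is_induced_succ mul B succ \<and> is_induced_prec mul B prec \<longrightarrow>
          quadratic_special_pre_leibniz_algebra scale succ prec B)) \<and>
     (\<forall>succ prec B. quadratic_special_pre_leibniz_algebra scale succ prec B \<longrightarrow>
        left_invariant (sub_adjacent succ prec) B) \<and>
     bij_betw to_quadratic (leibniz_with_form_structures scale)
        (quadratic_special_structures scale) \<and>
     bij_betw to_leibniz (quadratic_special_structures scale)
        (leibniz_with_form_structures scale) \<and>
     (\<forall>L \<in> leibniz_with_form_structures scale. to_leibniz (to_quadratic L) = L) \<and>
     (\<forall>Q \<in> quadratic_special_structures scale. to_quadratic (to_leibniz Q) = Q)"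
proof -
  have ex1_prec: "\<exists>!prec. is_induced_prec mul B prec"
    and ex1_succ: "\<exists>!succ. is_induced_succ mul B succ"
    if "leibniz_algebra_with_form scale mul B" for mul :: "'v \<Rightarrow> 'v \<Rightarrow> 'v" and B :: "'v \<Rightarrow> 'v \<Rightarrow> 'k"
  proof -
    interpret leibniz_algebra_with_form scale mul B by fact
    obtain prec where prec: "is_induced_prec mul B prec"
      using induced_prec_exists[OF assms] by blast
    then show "\<exists>!prec. is_induced_prec mul B prec"
      using induced_prec_unique by blast
    show "\<exists>!succ. is_induced_succ mul B succ"
      \<comment> \<open>Once some \<open>prec\<close> is fixed, the condition on \<open>succ\<close>
        is equality with one explicit function.\<close>
      unfolding induced_succ_iff[OF prec] by blast
  qed
  have the_induced: "is_induced_succ mul B (induced_succ mul B)"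
    "is_induced_prec mul B (induced_prec mul B)"
    if "leibniz_algebra_with_form scale mul B" for mul :: "'v \<Rightarrow> 'v \<Rightarrow> 'v" and B :: "'v \<Rightarrow> 'v \<Rightarrow> 'k"
    unfolding induced_succ_def induced_prec_def
    using theI'[OF ex1_succ[OF that]] theI'[OF ex1_prec[OF that]] .
  have to_quadratic_in: "to_quadratic L \<in> quadratic_special_structures scale"
    and leibniz_round_trip: "to_leibniz (to_quadratic L) = L"
    if "L \<in> leibniz_with_form_structures scale" for L
  proof -
    obtain mul B where L: "L = (mul, B)"
      by (cases L)
    then have alg: "leibniz_algebra_with_form scale mul B"
      using that by (simp add: leibniz_with_form_structures_def)
    show "to_quadratic L \<in> quadratic_special_structures scale"
      using leibniz_algebra_with_form.induced_quadratic[OF alg the_induced[OF alg]]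
      by (simp add: L to_quadratic_def quadratic_special_structures_def)
    show "to_leibniz (to_quadratic L) = L"
      using leibniz_algebra_with_form.sub_adjacent_induced[OF alg the_induced[OF alg]]
      by (simp add: L to_quadratic_def to_leibniz_def)
  qed
  have to_leibniz_in: "to_leibniz Q \<in> leibniz_with_form_structures scale"
    and quadratic_round_trip: "to_quadratic (to_leibniz Q) = Q"
    if "Q \<in> quadratic_special_structures scale" for Q
  proof -
    obtain succ prec B where Q: "Q = (succ, prec, B)"
      by (cases Q)
    interpret quadratic_special_pre_leibniz_algebra scale succ prec B
      using that by (simp add: Q quadratic_special_structures_def)
    note alg = leibniz_algebra_with_form_sub_adjacent
    show "to_leibniz Q \<in> leibniz_with_form_structures scale"
      using alg by (simp add: Q to_leibniz_def leibniz_with_form_structures_def)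
    \<comment> \<open>The given \<open>succ\<close> and the one chosen by \<open>THE\<close> satisfy
      the same defining equation, whose solution is unique; likewise for
      \<open>prec\<close>.\<close>
    have "induced_succ (sub_adjacent succ prec) B = succ"
      using ex1_succ[OF alg] the_induced(1)[OF alg] is_induced_succ_sub_adjacent by blast
    moreover have "induced_prec (sub_adjacent succ prec) B = prec"
      using ex1_prec[OF alg] the_induced(2)[OF alg] is_induced_prec_sub_adjacent by blast
    ultimately show "to_quadratic (to_leibniz Q) = Q"
      by (simp add: Q to_quadratic_def to_leibniz_def)
  qed
  have bij_to_quadratic: "bij_betw to_quadratic (leibniz_with_form_structures scale)
      (quadratic_special_structures scale)"
    by (rule bij_betw_byWitness[where f' = to_leibniz])
      (auto simp: to_quadratic_in to_leibniz_in leibniz_round_trip quadratic_round_trip)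
  have bij_to_leibniz: "bij_betw to_leibniz (quadratic_special_structures scale)
      (leibniz_with_form_structures scale)"
    by (rule bij_betw_byWitness[where f' = to_quadratic])
      (auto simp: to_quadratic_in to_leibniz_in leibniz_round_trip quadratic_round_trip)
  show ?thesis
  proof (intro conjI allI impI ballI)
    fix mul B succ prec
    assume "leibniz_algebra_with_form scale mul B"
      and "is_induced_succ mul B succ \<and> is_induced_prec mul B prec"
    then show "quadratic_special_pre_leibniz_algebra scale succ prec B"
      using leibniz_algebra_with_form.induced_quadratic by blast
  qed (rule ex1_succ ex1_prec bij_to_quadratic bij_to_leibniz leibniz_round_trip
      quadratic_round_trip quadratic_special_pre_leibniz_algebra.left_invariant_sub_adjacent
    | assumption)+
qed

end
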